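(* Let $\pi/3\le\theta\le 2\pi/3$, and let $\tilde{C}_\theta=\{e^{\theta\mathbf{u}}:\mathbf{u}\in S^2\}\subset \mathrm{SU}(2)$. If $C$ is a non-trivial coloring of the figure eight knot by $\tilde{C}_\theta$ with initial arc colored by $\mathbf{x}_\theta=e^{\theta\mathbf{i}}$, then $$\mathcal{L}_\theta(C)=\bigl(\cos(4\theta)-\cos(2\theta)-1\bigr)\pm\sqrt{-1+2\cos(4\theta)-4\cos(2\theta)}\;\sin(2\theta)\,\mathbf{i},$$ where the sign $\pm$ depends on which of the two angles $\beta_1,\beta_2$ (given in the context, with $\psi=2\pi-2\theta$) is realized by the coloring $C$.
   Context: $\mathrm{SU}(2)$ is the group of unit quaternions, $S^2$ is the set of pure unit quaternions, and $e^{\theta\mathbf{u}}=\cos\theta+\sin\theta\,\mathbf{u}$ for $\mathbf{u}\in S^2$. $\tilde C_\theta$ is a conjugacy class of $\mathrm{SU}(2)$, regarded as a quandle under $a*b=b^{-1}ab$. The figure eight knot is represented by a 1-tangle diagram with arcs $0,1,2,3,4$ (in order along the tangle), so that a coloring by $\tilde{C}_\theta$ with initial color $\mathbf{x}_\theta$ is a sequence $(\mathbf{u}_0,\mathbf{u}_1,\mathbf{u}_2,\mathbf{u}_3)$ in $\tilde{C}_\theta$, $\mathbf{u}_0=e^{\theta\mathbf{i}}$ (the terminal arc has color $\mathbf{u}_4=\mathbf{u}_0$), satisfying $$\mathbf{u}_0*\mathbf{u}_2=\mathbf{u}_1,\quad \mathbf{u}_0*\mathbf{u}_1=\mathbf{u}_3,\quad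 \mathbf{u}_2*\mathbf{u}_3=\mathbf{u}_1,\quad \mathbf{u}_2*\mathbf{u}_0=\mathbf{u}_3 .$$ It is non-trivial if it is not constant. The longitudinal mapping (image of the preferred longitude) is $\mathcal{L}_\theta(C)=\mathbf{u}_2\mathbf{u}_3^{-1}\mathbf{u}_0\mathbf{u}_1^{-1}$. Write $\mathbf{u}_i=e^{\theta\mathbf{v}_i}$ with $\mathbf{v}_i\in S^2$. For a non-trivial coloring the angle $\beta\in(0,\pi)$ between $\mathbf{v}_0=\mathbf{i}$ and $\mathbf{v}_2$ is one of $\beta_1,\beta_2$, where, with $\psi=2\pi-2\theta$, $$\beta_1=\pi-\arccos\frac{-1+\sqrt{4\cos^2\psi-4\cos\psi-3}}{2(\cos\psi-1)},\qquad \beta_2=\arccos\frac{1+\sqrt{4\cos^2\psi-4\cos\psi-3}}{2(\cos\psi-1)} .$$ *)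

theory Defs
  imports "HOL-Analysis.Analysis"
begin

section \<open>The quaternions\<close>

text \<open>\<^term>\<open>Quat a b c d\<close> stands for $a + b\mathbf{i} + c\mathbf{j} + d\mathbf{k}$.\<close>

datatype quat = Quat (qRe: real) (qIm1: real) (qIm2: real) (qIm3: real)

lemma quat_eq_iff:
  "p = q \<longleftrightarrow> qRe p = qRe q \<and> qIm1 p = qIm1 q \<and> qIm2 p = qIm2 q \<and> qIm3 p = qIm3 q"
  by (auto intro: quat.expand)

instantiation quat :: real_algebra_1
begin

definition zero_quat :: quat where "0 = Quat 0 0 0 0"

definition one_quat :: quat where "1 = Quat 1 0 0 0"

definition plus_quat :: "quat \<Rightarrow> quat \<Rightarrow> quat" where
  "p + q = Quat (qRe p + qRe q) (qIm1 p + qIm1 q) (qIm2 p + qIm2 q) (qIm3 p + qIm3 q)"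

definition uminus_quat :: "quat \<Rightarrow> quat" where
  "- p = Quat (- qRe p) (- qIm1 p) (- qIm2 p) (- qIm3 p)"

definition minus_quat :: "quat \<Rightarrow> quat \<Rightarrow> quat" where
  "p - q = Quat (qRe p - qRe q) (qIm1 p - qIm1 q) (qIm2 p - qIm2 q) (qIm3 p - qIm3 q)"

definition times_quat :: "quat \<Rightarrow> quat \<Rightarrow> quat" where
  "p * q = Quat
     (qRe p * qRe q - qIm1 p * qIm1 q - qIm2 p * qIm2 q - qIm3 p * qIm3 q)
     (qRe p * qIm1 q + qIm1 p * qRe q + qIm2 p * qIm3 q - qIm3 p * qIm2 q)
     (qRe p * qIm2 q - qIm1 p * qIm3 q + qIm2 p * qRe q + qIm3 p * qIm1 q)
     (qRe p * qIm3 q + qIm1 p * qIm2 q - qIm2 p * qIm1 q + qIm3 p * qRe q)"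

definition scaleR_quat :: "real \<Rightarrow> quat \<Rightarrow> quat" where
  "scaleR r p = Quat (r * qRe p) (r * qIm1 p) (r * qIm2 p) (r * qIm3 p)"

instance
  by standard (auto simp: quat_eq_iff zero_quat_def one_quat_def plus_quat_def
      uminus_quat_def minus_quat_def times_quat_def scaleR_quat_def algebra_simps)

end

lemma quat_sel_simps [simp]:
  "qRe 0 = 0" "qIm1 0 = 0" "qIm2 0 = 0" "qIm3 0 = 0"
  "qRe 1 = 1" "qIm1 1 = 0" "qIm2 1 = 0" "qIm3 1 = 0"
  "qRe (p + q) = qRe p + qRe q" "qIm1 (p + q) = qIm1 p + qIm1 q"
  "qIm2 (p + q) = qIm2 p + qIm2 q" "qIm3 (p + q) = qIm3 p + qIm3 q"
  "qRe (- p) = - qRe p" "qIm1 (- p) = - qIm1 p" "qIm2 (- p) = - qIm2 p" "qIm3 (- p) = - qIm3 p"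
  "qRe (p - q) = qRe p - qRe q" "qIm1 (p - q) = qIm1 p - qIm1 q"
  "qIm2 (p - q) = qIm2 p - qIm2 q" "qIm3 (p - q) = qIm3 p - qIm3 q"
  "qRe (r *\<^sub>R p) = r * qRe p" "qIm1 (r *\<^sub>R p) = r * qIm1 p"
  "qIm2 (r *\<^sub>R p) = r * qIm2 p" "qIm3 (r *\<^sub>R p) = r * qIm3 p"
  by (simp_all add: zero_quat_def one_quat_def plus_quat_def uminus_quat_def
      minus_quat_def scaleR_quat_def)

lemma quat_mult_sel:
  "qRe (p * q) = qRe p * qRe q - qIm1 p * qIm1 q - qIm2 p * qIm2 q - qIm3 p * qIm3 q"
  "qIm1 (p * q) = qRe p * qIm1 q + qIm1 p * qRe q + qIm2 p * qIm3 q - qIm3 p * qIm2 q"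
  "qIm2 (p * q) = qRe p * qIm2 q - qIm1 p * qIm3 q + qIm2 p * qRe q + qIm3 p * qIm1 q"
  "qIm3 (p * q) = qRe p * qIm3 q + qIm1 p * qIm2 q - qIm2 p * qIm1 q + qIm3 p * qRe q"
  by (simp_all add: times_quat_def)

instantiation quat :: real_normed_vector
begin

definition norm_quat :: "quat \<Rightarrow> real" where
  "norm p = sqrt ((qRe p)\<^sup>2 + (qIm1 p)\<^sup>2 + (qIm2 p)\<^sup>2 + (qIm3 p)\<^sup>2)"

definition sgn_quat_def: "sgn (p::quat) = p /\<^sub>R norm p"

definition dist_quat_def: "dist (p::quat) q = norm (p - q)"

definition uniformity_quat_def:
  "(uniformity :: (quat \<times> quat) filter) = (INF e\<in>{0<..}. principal {(x, y). dist x y < e})"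

definition open_quat_def:
  "open (U :: quat set) \<longleftrightarrow> (\<forall>x\<in>U. eventually (\<lambda>(x', y). x' = x \<longrightarrow> y \<in> U) uniformity)"

instance
proof
  fix p q :: quat and a :: real
  have norm_prod: "norm x = norm ((qRe x, qIm1 x), (qIm2 x, qIm3 x))" for x :: quat
    by (simp add: norm_quat_def norm_Pair)
  show "dist p q = norm (p - q)" by (rule dist_quat_def)
  show "sgn p = p /\<^sub>R norm p" by (rule sgn_quat_def)
  show "uniformity = (INF e\<in>{0<..}. principal {(x::quat, y). dist x y < e})"
    by (rule uniformity_quat_def)
  show "open U \<longleftrightarrow> (\<forall>x\<in>U. eventually (\<lambda>(x', y). x' = x \<longrightarrow> y \<in> U) uniformity)"
    for U :: "quat set"
    by (rule open_quat_def)
  show "norm p = 0 \<longleftrightarrow> p = 0"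
    by (simp only: norm_prod norm_eq_zero) (simp add: quat_eq_iff zero_prod_def)
  show "norm (p + q) \<le> norm p + norm q"
    unfolding norm_prod
    by (rule order_trans[OF _ norm_triangle_ineq]) simp
  have "norm (a *\<^sub>R p) = norm (a *\<^sub>R ((qRe p, qIm1 p), (qIm2 p, qIm3 p)))"
    by (simp add: norm_prod)
  then show "norm (a *\<^sub>R p) = \<bar>a\<bar> * norm p"
    by (simp only: norm_scaleR norm_prod)
qed

end

instantiation quat :: real_inner
begin

definition inner_quat :: "quat \<Rightarrow> quat \<Rightarrow> real" where
  "inner p q = qRe p * qRe q + qIm1 p * qIm1 q + qIm2 p * qIm2 q + qIm3 p * qIm3 q"

instance
proof
  fix p q r :: quat and a :: real
  show "norm p = sqrt (inner p p)"
    by (simp add: norm_quat_def inner_quat_def power2_eq_square)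
  show "inner p q = inner q p" by (simp add: inner_quat_def mult.commute)
  show "inner (p + q) r = inner p r + inner q r"
    by (simp add: inner_quat_def algebra_simps)
  show "inner (a *\<^sub>R p) q = a * inner p q"
    by (simp add: inner_quat_def algebra_simps)
  show "0 \<le> inner p p" by (simp add: inner_quat_def)
  show "inner p p = 0 \<longleftrightarrow> p = 0"
    by (auto simp: inner_quat_def quat_eq_iff add_nonneg_eq_0_iff)
qed

end

instantiation quat :: real_normed_div_algebra
begin

definition inverse_quat :: "quat \<Rightarrow> quat" where
  "inverse p = Quat (qRe p) (- qIm1 p) (- qIm2 p) (- qIm3 p) /\<^sub>R (norm p)\<^sup>2"

definition divide_quat :: "quat \<Rightarrow> quat \<Rightarrow> quat" where
  "divide_quat p q = p * inverse q"

instance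
proof
  fix p q :: quat
  have nsq: "(norm x)\<^sup>2 = qRe x * qRe x + qIm1 x * qIm1 x + qIm2 x * qIm2 x + qIm3 x * qIm3 x"
    for x :: quat
    by (simp add: power2_norm_eq_inner inner_quat_def)
  show "inverse p * p = 1" "p * inverse p = 1" if "p \<noteq> 0"
  proof -
    define r where "r = inverse ((norm p)\<^sup>2)"
    have "r * (norm p)\<^sup>2 = 1"
      using that by (simp add: r_def)
    then have 1: "r * (qRe p * qRe p + qIm1 p * qIm1 p + qIm2 p * qIm2 p + qIm3 p * qIm3 p) = 1"
      by (simp only: nsq)
    have 2: "inverse p = Quat (r * qRe p) (r * - qIm1 p) (r * - qIm2 p) (r * - qIm3 p)"
      by (simp add: inverse_quat_def r_def scaleR_quat_def)
    show "inverse p * p = 1" "p * inverse p = 1"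
      using 1 by (simp_all add: 2 quat_eq_iff quat_mult_sel algebra_simps)
  qed
  show "p div q = p * inverse q" by (rule divide_quat_def)
  show "inverse (0::quat) = 0" by (simp add: inverse_quat_def quat_eq_iff)
  have "(norm (p * q))\<^sup>2 = (norm p * norm q)\<^sup>2"
    unfolding power_mult_distrib nsq quat_mult_sel by algebra
  then show "norm (p * q) = norm p * norm q"
    by (simp add: power2_eq_iff_nonneg)
qed

end

definition quat_i :: quat where
  "quat_i = Quat 0 1 0 0"

section \<open>The quandles $\tilde C_\theta$\<close>

text \<open>Pure unit quaternions.\<close>

definition S2 :: "quat set" where
  "S2 = {u. qRe u = 0 \<and> norm u = 1}"

text \<open>$e^{\theta\mathbf{u}}$, for \<^term>\<open>u \<in> S2\<close>.\<close>

definition qexp :: "real \<Rightarrow> quat \<Rightarrow> quat" where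
  "qexp \<theta> u = of_real (cos \<theta>) + sin \<theta> *\<^sub>R u"

definition C_tilde :: "real \<Rightarrow> quat set" where
  "C_tilde \<theta> = qexp \<theta> ` S2"

definition quandle_op :: "quat \<Rightarrow> quat \<Rightarrow> quat" (infixl "\<lhd>\<^sub>q" 70) where
  "a \<lhd>\<^sub>q b = inverse b * a * b"

text \<open>The $\mathbf{v} \in S^2$ with $q = e^{\theta\mathbf{v}}$. It exists for
  \<^term>\<open>q \<in> C_tilde \<theta>\<close> and is unique when \<^term>\<open>sin \<theta> \<noteq> 0\<close>.\<close>

definition axis_of :: "real \<Rightarrow> quat \<Rightarrow> quat" where
  "axis_of \<theta> q = (THE v. v \<in> S2 \<and> q = qexp \<theta> v)"

text \<open>The angle between two unit vectors.\<close>

definition angle :: "quat \<Rightarrow> quat \<Rightarrow> real" where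
  "angle u v = arccos (inner u v)"

section \<open>Colorings of the figure eight knot\<close>

text \<open>The knot is given by a 1-tangle diagram with arcs $0, \dots, 4$ in order along the tangle;
  \<^term>\<open>u k\<close> is the color of arc \<^term>\<open>k\<close>, and values at \<^term>\<open>k > 4\<close> are irrelevant. The
  four relations come from the four crossings.\<close>

definition fig8_coloring :: "real \<Rightarrow> (nat \<Rightarrow> quat) \<Rightarrow> bool" where
  "fig8_coloring \<theta> u \<longleftrightarrow>
     (\<forall>k\<le>4. u k \<in> C_tilde \<theta>) \<and> u 4 = u 0 \<and>
     u 0 \<lhd>\<^sub>q u 2 = u 1 \<and> u 0 \<lhd>\<^sub>q u 1 = u 3 \<and> u 2 \<lhd>\<^sub>q u 3 = u 1 \<and> u 2 \<lhd>\<^sub>q u 0 = u 3"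

definition nontrivial_coloring :: "(nat \<Rightarrow> quat) \<Rightarrow> bool" where
  "nontrivial_coloring u \<longleftrightarrow> \<not> (\<exists>c. \<forall>k\<le>4. u k = c)"

text \<open>The image of the preferred longitude.\<close>

definition longitudinal :: "(nat \<Rightarrow> quat) \<Rightarrow> quat" where
  "longitudinal u = u 2 * inverse (u 3) * u 0 * inverse (u 1)"

definition coloring_angle :: "real \<Rightarrow> (nat \<Rightarrow> quat) \<Rightarrow> real" where
  "coloring_angle \<theta> u = angle (axis_of \<theta> (u 0)) (axis_of \<theta> (u 2))"

definition beta1 :: "real \<Rightarrow> real" where
  "beta1 \<theta> = (let \<psi> = 2 * pi - 2 * \<theta> in
     pi - arccos ((- 1 + sqrt (4 * (cos \<psi>)\<^sup>2 - 4 * cos \<psi> - 3)) / (2 * (cos \<psi> - 1))))"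

definition beta2 :: "real \<Rightarrow> real" where
  "beta2 \<theta> = (let \<psi> = 2 * pi - 2 * \<theta> in
     arccos ((1 + sqrt (4 * (cos \<psi>)\<^sup>2 - 4 * cos \<psi> - 3)) / (2 * (cos \<psi> - 1))))"

end

theory Submission
  imports Defs
begin

text \<open>Let \<open>u\<^sub>0 = c + s i\<close> and \<open>u\<^sub>2 = c + s v\<close> with \<open>v = x i + y j + z k\<close>. Two of the crossing
  relations express \<open>u\<^sub>1\<close> and \<open>u\<^sub>3\<close> through \<open>u\<^sub>0\<close> and \<open>u\<^sub>2\<close>, by rotating \<open>i\<close> about \<open>v\<close> and \<open>v\<close>
  about \<open>i\<close>. The component of \<open>u\<^sub>0 u\<^sub>1 = u\<^sub>1 u\<^sub>3\<close> along \<open>i \<times> v\<close>, which is nonzero for a non-trivial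
  coloring, is a quadratic equation for \<open>x\<close>, the cosine of the coloring angle. Modulo that
  equation the longitude is a combination of \<open>1\<close> and \<open>i\<close>, with \<open>i\<close>-coefficient affine in \<open>x\<close>, so
  the choice of the root \<open>x\<close> decides the sign.\<close>

lemma Quat_mult:
  "Quat a b c d * Quat a' b' c' d' = Quat
     (a * a' - b * b' - c * c' - d * d') (a * b' + b * a' + c * d' - d * c')
     (a * c' - b * d' + c * a' + d * b') (a * d' + b * c' - c * b' + d * a')"
  by (simp add: times_quat_def)

lemma inverse_Quat_unit:
  assumes "a\<^sup>2 + b\<^sup>2 + c\<^sup>2 + d\<^sup>2 = 1"
  shows "inverse (Quat a b c d) = Quat a (- b) (- c) (- d)"
  using assms by (simp add: inverse_quat_def norm_quat_def)

lemma qexp_eq_Quat: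
  "qexp \<theta> u = Quat (cos \<theta> + sin \<theta> * qRe u) (sin \<theta> * qIm1 u) (sin \<theta> * qIm2 u) (sin \<theta> * qIm3 u)"
  by (simp add: qexp_def quat_eq_iff of_real_def)

lemma axis_of_qexp:
  assumes "sin \<theta> \<noteq> 0" "v \<in> S2"
  shows "axis_of \<theta> (qexp \<theta> v) = v"
  unfolding axis_of_def using assms
  by (intro the_equality) (auto simp: qexp_def)

context
  fixes c s x y z :: real
  assumes cs: "c\<^sup>2 + s\<^sup>2 = 1" and xyz: "x\<^sup>2 + y\<^sup>2 + z\<^sup>2 = 1"
begin

private definition "u0 = Quat c s 0 0"
private definition "u2 = Quat c (s * x) (s * y) (s * z)"
text \<open>Rodrigues' formula: conjugation by \<open>u2\<close> rotates i about v through minus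
  twice the angle of \<open>c\<close> and \<open>s\<close>, whose cosine and sine are
  \<open>1 - 2 * s\<^sup>2\<close> and \<open>2 * s * c\<close>. In \<open>u3\<close> the roles of i
  and v are exchanged.\<close>

private definition "u1 = Quat c (s * (1 - 2 * s\<^sup>2 + 2 * s\<^sup>2 * x\<^sup>2))
  (s * (2 * s\<^sup>2 * x * y - 2 * s * c * z)) (s * (2 * s\<^sup>2 * x * z + 2 * s * c * y))"
private definition "u3 = Quat c (s * x)
  (s * ((1 - 2 * s\<^sup>2) * y + 2 * s * c * z)) (s * ((1 - 2 * s\<^sup>2) * z - 2 * s * c * y))"

private lemma inv_u0: "inverse u0 = Quat c (- s) 0 0"
  unfolding u0_def using cs by (subst inverse_Quat_unit) auto

private lemma inv_u2: "inverse u2 = Quat c (- (s * x)) (- (s * y)) (- (s * z))"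
  unfolding u2_def by (rule inverse_Quat_unit) (use cs xyz in algebra)

private lemma inv_u1: "inverse u1 = Quat c (- (s * (1 - 2 * s\<^sup>2 + 2 * s\<^sup>2 * x\<^sup>2)))
  (- (s * (2 * s\<^sup>2 * x * y - 2 * s * c * z))) (- (s * (2 * s\<^sup>2 * x * z + 2 * s * c * y)))"
  unfolding u1_def by (rule inverse_Quat_unit) (use cs xyz in algebra)

private lemma inv_u3: "inverse u3 = Quat c (- (s * x))
  (- (s * ((1 - 2 * s\<^sup>2) * y + 2 * s * c * z))) (- (s * ((1 - 2 * s\<^sup>2) * z - 2 * s * c * y)))"
  unfolding u3_def by (rule inverse_Quat_unit) (use cs xyz in algebra)

private lemma quandle_op_02: "u0 \<lhd>\<^sub>q u2 = u1"
  unfolding quandle_op_def inv_u2 unfolding u0_def u1_def u2_def Quat_mult quat.inject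
  apply (intro conjI)
     apply (use cs xyz in algebra)
    apply (use cs xyz in algebra)
   apply (simp_all add: algebra_simps power2_eq_square)
  done

private lemma quandle_op_20: "u2 \<lhd>\<^sub>q u0 = u3"
  unfolding quandle_op_def inv_u0 unfolding u0_def u3_def u2_def Quat_mult quat.inject
  by (intro conjI; use cs xyz in algebra)

text \<open>Rotation about i preserves the relation and acts transitively on the v with given
  \<open>x\<close>, so the resulting condition can involve \<open>x\<close> alone.\<close>

private lemma Riley_equation:
  assumes "u0 \<lhd>\<^sub>q u1 = u3" "s \<noteq> 0" "y \<noteq> 0 \<or> z \<noteq> 0"
  shows "4 * s ^ 4 * x\<^sup>2 + 2 * s\<^sup>2 * x - 4 * s ^ 4 + 2 * s\<^sup>2 + 1 = 0" (is "?P = 0")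
proof -
  \<comment> \<open>Once \<open>u1\<close> is invertible, multiplying by it clears the inverse and
    leaves a polynomial identity.\<close>
  have "u0 \<noteq> 0" "u2 \<noteq> 0"
    using assms(2,3) by (auto simp: u0_def u2_def zero_quat_def)
  then have "u1 \<noteq> 0"
    by (simp add: quandle_op_02[symmetric] quandle_op_def)
  then have "u0 * u1 = u1 * u3"
    using assms(1)[symmetric] by (simp add: quandle_op_def mult.assoc[symmetric])
  then have "qIm2 (u0 * u1) = qIm2 (u1 * u3)" "qIm3 (u0 * u1) = qIm3 (u1 * u3)" by auto
  \<comment> \<open>the component along \<open>i \<times> v = (0, -z, y)\<close>\<close>
  then have "(y\<^sup>2 + z\<^sup>2) * s\<^sup>2 * ?P = 0"
    unfolding u0_def u1_def u3_def Quat_mult quat.sel using cs xyz by algebra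
  then show ?thesis using assms by (auto simp: add_nonneg_eq_0_iff)
qed

text \<open>Conjugation by the longitude takes the initial color to the terminal one, which is the
  same, so the longitude commutes with \<open>u0\<close> and has no j or k part. The real part is
  arranged for the double-angle formulas.\<close>

private lemma longitude_eq:
  assumes "4 * s ^ 4 * x\<^sup>2 + 2 * s\<^sup>2 * x - 4 * s ^ 4 + 2 * s\<^sup>2 + 1 = 0"
  shows "u2 * inverse u3 * u0 * inverse u1 = 
    Quat (2 * (1 - 2 * s\<^sup>2)\<^sup>2 - 1 - (1 - 2 * s\<^sup>2) - 1) (- (1 + 4 * s\<^sup>2 * x) * (2 * s * c)) 0 0"
  unfolding inv_u1 inv_u3 mult.assoc unfolding u0_def u2_def Quat_mult quat.inject
  by (intro conjI; use cs xyz assms in algebra)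

lemma fig8_angle_and_longitude:
  fixes u :: "nat \<Rightarrow> quat"
  assumes "u 0 = Quat c s 0 0" "u 2 = Quat c (s * x) (s * y) (s * z)"
    and "u 0 \<lhd>\<^sub>q u 2 = u 1" "u 0 \<lhd>\<^sub>q u 1 = u 3" "u 2 \<lhd>\<^sub>q u 0 = u 3"
    and "s \<noteq> 0" "y \<noteq> 0 \<or> z \<noteq> 0"
  shows "4 * s ^ 4 * x\<^sup>2 + 2 * s\<^sup>2 * x - 4 * s ^ 4 + 2 * s\<^sup>2 + 1 = 0"
    and "longitudinal u =
      Quat (2 * (1 - 2 * s\<^sup>2)\<^sup>2 - 1 - (1 - 2 * s\<^sup>2) - 1) (- (1 + 4 * s\<^sup>2 * x) * (2 * s * c)) 0 0"
proof -
  have u: "u 0 = u0" "u 2 = u2" "u 1 = u1" "u 3 = u3"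
    using assms(1-5) quandle_op_02 quandle_op_20 by (simp_all add: u0_def u2_def)
  show "4 * s ^ 4 * x\<^sup>2 + 2 * s\<^sup>2 * x - 4 * s ^ 4 + 2 * s\<^sup>2 + 1 = 0"
    using Riley_equation[OF _ assms(6,7)] assms(4)[unfolded u] by blast
  then show "longitudinal u =
      Quat (2 * (1 - 2 * s\<^sup>2)\<^sup>2 - 1 - (1 - 2 * s\<^sup>2) - 1) (- (1 + 4 * s\<^sup>2 * x) * (2 * s * c)) 0 0"
    unfolding longitudinal_def u by (rule longitude_eq)
qed

end

text \<open>Conjugation by a commuting element does nothing, so the relations collapse all colors to
  one. This excludes v = i and v = -i, where i \<times> v vanishes.\<close>

lemma fig8_coloring_trivial_if_commute:
  assumes "fig8_coloring \<theta> u" "u 0 * u 2 = u 2 * u 0" "u 0 \<noteq> 0" "u 2 \<noteq> 0"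
  shows "\<not> nontrivial_coloring u"
proof -
  have rels: "u 4 = u 0" "u 0 \<lhd>\<^sub>q u 2 = u 1" "u 0 \<lhd>\<^sub>q u 1 = u 3" "u 2 \<lhd>\<^sub>q u 0 = u 3"
    using assms(1) by (simp_all add: fig8_coloring_def)
  have "u 1 = inverse (u 2) * (u 2 * u 0)" "u 3 = inverse (u 0) * (u 0 * u 2)"
    using rels(2,4) by (simp_all add: quandle_op_def mult.assoc assms(2))
  then have "u 1 = u 0" "u 3 = u 2"
    using assms(3,4) by (simp_all flip: mult.assoc)
  then have "u 1 = u 0" "u 2 = u 0" "u 3 = u 0"
    using rels(3) assms(3) by (simp_all add: quandle_op_def)
  have "u k = u 0" if "k \<le> 4" for k
  proof -
    consider "k = 0" | "k = 1" | "k = 2" | "k = 3" | "k = 4"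
      using \<open>k \<le> 4\<close> by linarith
    then show ?thesis
      by cases (simp_all only: rels(1) \<open>u 1 = u 0\<close> \<open>u 2 = u 0\<close> \<open>u 3 = u 0\<close>)
  qed
  then show ?thesis
    unfolding nontrivial_coloring_def by blast
qed

theorem proposition6p8:
  fixes \<theta> :: real and C :: "nat \<Rightarrow> quat"
  assumes "pi / 3 \<le> \<theta>" and "\<theta> \<le> 2 * pi / 3"
    and "fig8_coloring \<theta> C"
    and "nontrivial_coloring C"
    and "C 0 = qexp \<theta> quat_i"
  shows
    "(coloring_angle \<theta> C = beta1 \<theta> \<and>
      longitudinal C = of_real (cos (4 * \<theta>) - cos (2 * \<theta>) - 1)
        - (sqrt (- 1 + 2 * cos (4 * \<theta>) - 4 * cos (2 * \<theta>)) * sin (2 * \<theta>)) *\<^sub>R quat_i)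
   \<or> (coloring_angle \<theta> C = beta2 \<theta> \<and>
      longitudinal C = of_real (cos (4 * \<theta>) - cos (2 * \<theta>) - 1)
        + (sqrt (- 1 + 2 * cos (4 * \<theta>) - 4 * cos (2 * \<theta>)) * sin (2 * \<theta>)) *\<^sub>R quat_i)"
proof -
  define c s where "c = cos \<theta>" and "s = sin \<theta>"
  have "s > 0"
    unfolding s_def using assms(1,2) pi_gt_zero by (intro sin_gt_zero) linarith+
  have cs: "c\<^sup>2 + s\<^sup>2 = 1"
    by (simp add: c_def s_def)
  have "C 2 \<in> C_tilde \<theta>"
    using assms(3) by (simp add: fig8_coloring_def)
  then obtain v where v: "v \<in> S2" "C 2 = qexp \<theta> v"
    by (auto simp: C_tilde_def)
  define x y z where "x = qIm1 v" and "y = qIm2 v" and "z = qIm3 v"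
  have xyz: "x\<^sup>2 + y\<^sup>2 + z\<^sup>2 = 1" and [simp]: "qRe v = 0"
    using v(1) by (auto simp: S2_def norm_quat_def x_def y_def z_def)
  have C0: "C 0 = Quat c s 0 0" and C2: "C 2 = Quat c (s * x) (s * y) (s * z)"
    using assms(5) v(2) by (simp_all add: qexp_eq_Quat quat_i_def c_def s_def x_def y_def z_def)
  have yz: "y \<noteq> 0 \<or> z \<noteq> 0"
  proof (rule ccontr)
    assume *: "\<not> ?thesis"
    have "C 0 * C 2 = C 2 * C 0"
      using * by (simp add: C0 C2 Quat_mult)
    moreover have "C 0 \<noteq> 0" "C 2 \<noteq> 0"
      using * xyz \<open>s > 0\<close> by (auto simp: C0 C2 zero_quat_def)
    ultimately show False
      using fig8_coloring_trivial_if_commute assms(3,4) by blast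
  qed
  have rels: "C 0 \<lhd>\<^sub>q C 2 = C 1" "C 0 \<lhd>\<^sub>q C 1 = C 3" "C 2 \<lhd>\<^sub>q C 0 = C 3"
    using assms(3) by (simp_all add: fig8_coloring_def)
  note core = fig8_angle_and_longitude[OF cs xyz C0 C2 rels less_imp_neq[OF \<open>s > 0\<close>, symmetric] yz]
  define K where "K = cos (2 * \<theta>)"
  have K: "K = 1 - 2 * s\<^sup>2"
    by (simp add: K_def s_def cos_double_sin)
  have cos4: "cos (4 * \<theta>) = 2 * K\<^sup>2 - 1"
    using cos_double_cos[of "2 * \<theta>"] by (simp add: K_def)
  have sin2: "sin (2 * \<theta>) = 2 * s * c"
    by (simp add: s_def c_def sin_double)
  have "K < 1"
    using K \<open>s > 0\<close> by simp
  define r where "r = sqrt (4 * K\<^sup>2 - 4 * K - 3)"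
  have r: "sqrt (- 1 + 2 * cos (4 * \<theta>) - 4 * cos (2 * \<theta>)) = r"
    by (simp add: r_def cos4 flip: K_def)
  \<comment> \<open>Completing the square in the quadratic for \<open>x\<close>. The radicand is
    thus nonnegative, and the expression squared is also the factor of
    \<open>sin (2 * \<theta>)\<close> in the longitude.\<close>
  have "4 * K\<^sup>2 - 4 * K - 3 = (2 * (K - 1) * x - 1)\<^sup>2"
    using core(1) unfolding K by algebra
  then have r_abs: "r = \<bar>2 * (K - 1) * x - 1\<bar>"
    by (simp add: r_def)
  have "x\<^sup>2 \<le> 1"
    using xyz by (smt (verit) zero_le_power2)
  then have x: "-1 \<le> x" "x \<le> 1"
    using abs_le_square_iff[of x 1] by auto
  have "quat_i \<in> S2"
    by (simp add: S2_def quat_i_def norm_quat_def)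
  then have ang: "coloring_angle \<theta> C = arccos x"
    using v \<open>s > 0\<close> assms(5)
    by (simp add: coloring_angle_def angle_def axis_of_qexp s_def inner_quat_def quat_i_def x_def)
  have L: "longitudinal C = of_real (cos (4 * \<theta>) - cos (2 * \<theta>) - 1)
      + ((2 * (K - 1) * x - 1) * sin (2 * \<theta>)) *\<^sub>R quat_i"
    unfolding core(2) cos4 sin2 K_def[symmetric] unfolding K
    by (simp add: quat_eq_iff of_real_def quat_i_def algebra_simps)
  have cos_psi: "cos (2 * pi - 2 * \<theta>) = K"
    by (simp add: K_def cos_diff)
  show ?thesis
  \<comment> \<open>This expression is \<open>r\<close> or \<open>- r\<close>; its sign fixes both
    the root \<open>x\<close> and the sign in the longitude.\<close>
  proof (cases "2 * (K - 1) * x - 1 \<ge> 0")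
    case True
    then have "x = (1 + r) / (2 * (K - 1))"
      using r_abs \<open>K < 1\<close> by (simp add: field_simps)
    then have "coloring_angle \<theta> C = beta2 \<theta>"
      unfolding ang beta2_def Let_def cos_psi r_def[symmetric] by (rule arg_cong)
    with True show ?thesis
      using L r r_abs by simp
  next
    case False
    \<comment> \<open>\<open>beta1\<close> is written through the negated root, hence the reflection
      of \<open>arccos\<close> below.\<close>
    then have "(- 1 + r) / (2 * (K - 1)) = - x"
      using r_abs \<open>K < 1\<close> by (simp add: field_simps)
    then have "coloring_angle \<theta> C = beta1 \<theta>"
      unfolding ang beta1_def Let_def cos_psi r_def[symmetric] \<open>(- 1 + r) / (2 * (K - 1)) = - x\<close>
      using arccos_minus[OF x] by linarith
    moreover have "2 * (K - 1) * x - 1 = - r"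
      using False r_abs by simp
    ultimately show ?thesis
      using L r by simp
  qed
qed

end
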